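(* Let $f\in\Upsilon_n$ be a non-decomposable function of arity $n\geq 3$. Then there exist $j,k,\ell\in\{1,\dots,n\}$ with $j<k<\ell$, and $u_m\in\{\delta_0,\delta_1,\delta_+,\delta_-\}$ for all $m\in\{1,\dots,n\}\setminus\{j,k,\ell\}$, such that the ternary function \[ g(x_j,x_k,x_\ell)=\sum_{x_s\in\{0,1\}\text{ for } s\in\{1,\dots,n\}\setminus\{j,k,\ell\}} f(x_1,\dots,x_n)\prod_{m\in\{1,\dots,n\}\setminus\{j,k,\ell\}}u_m(x_m) \] is non-decomposable.
   Context: $\mathbb{A}$ denotes the algebraic complex numbers and $\Upsilon_n$ the set of functions $\{0,1\}^n\to\mathbb{A}$. $\delta_0(x)=1-x$, $\delta_1(x)=x$, $\delta_+(x)=1$, $\delta_-(x)=(-1)^x$. A function $f\in\Upsilon_n$ is decomposable if there exist a permutation $\rho$ of $\{1,\dots,n\}$, an integer $1\le k<n$ and functions $f_1\in\Upsilon_k$, $f_2\in\Upsilon_{n-k}$ such that $f(x_1,\dots,x_n)=f_1(x_{\rho(1)},\dots,x_{\rho(k)})f_2(x_{\rho(k+1)},\dots,x_{\rho(n)})$ for all inputs; otherwise it is non-decomposable. *)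

theory Defs
  imports
    "HOL-Computational_Algebra.Polynomial"
    "HOL-Combinatorics.Permutations"
    "HOL-Library.FuncSet"
    Complex_Main
begin

text \<open>
  An input \<open>(x\<^sub>1, \<dots>, x\<^sub>n) \<in> {0,1}\<^sup>n\<close> is the function \<open>i \<mapsto> x\<^sub>i\<close>, extensional on \<open>{1..n}\<close>, so that tuples are
  in bijection with elements of \<open>cube n\<close>; likewise functions on tuples are extensional on \<open>cube n\<close>.
\<close>

definition cube :: "nat \<Rightarrow> (nat \<Rightarrow> nat) set" where
  "cube n = {1..n} \<rightarrow>\<^sub>E {0, 1}"

definition Upsilon :: "nat \<Rightarrow> ((nat \<Rightarrow> nat) \<Rightarrow> complex) set" where
  "Upsilon n = cube n \<rightarrow>\<^sub>E {z. algebraic z}"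

text \<open>The functions below are only meant to be applied to bits, i.e. to \<open>0\<close> and \<open>1\<close>.\<close>

definition delta_zero :: "nat \<Rightarrow> complex" where
  "delta_zero x = 1 - of_nat x"

definition delta_one :: "nat \<Rightarrow> complex" where
  "delta_one x = of_nat x"

definition delta_plus :: "nat \<Rightarrow> complex" where
  "delta_plus x = 1"

definition delta_minus :: "nat \<Rightarrow> complex" where
  "delta_minus x = (- 1) ^ x"

definition decomposable :: "nat \<Rightarrow> ((nat \<Rightarrow> nat) \<Rightarrow> complex) \<Rightarrow> bool" where
  "decomposable n f \<longleftrightarrow>
    (\<exists>\<rho> k f1 f2. \<rho> permutes {1..n} \<and> 1 \<le> k \<and> k < n \<and>
      f1 \<in> Upsilon k \<and> f2 \<in> Upsilon (n - k) \<and>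
      (\<forall>x\<in>cube n. f x = f1 (\<lambda>i\<in>{1..k}. x (\<rho> i)) * f2 (\<lambda>i\<in>{1..n - k}. x (\<rho> (k + i)))))"

definition non_decomposable :: "nat \<Rightarrow> ((nat \<Rightarrow> nat) \<Rightarrow> complex) \<Rightarrow> bool" where
  "non_decomposable n f \<longleftrightarrow> f \<in> Upsilon n \<and> \<not> decomposable n f"

text \<open>
  The ternary function \<open>g(x\<^sub>j, x\<^sub>k, x\<^sub>l)\<close>: its arguments are renumbered, \<open>x\<^sub>j = y 1\<close>, \<open>x\<^sub>k = y 2\<close>,
  \<open>x\<^sub>l = y 3\<close>, and \<open>z\<close> ranges over the assignments to the remaining variables.
\<close>

definition ternary_gadget ::
  "nat \<Rightarrow> ((nat \<Rightarrow> nat) \<Rightarrow> complex) \<Rightarrow> (nat \<Rightarrow> nat \<Rightarrow> complex) \<Rightarrow> nat \<Rightarrow> nat \<Rightarrow> nat \<Rightarrow>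
    (nat \<Rightarrow> nat) \<Rightarrow> complex" where
  "ternary_gadget n f u j k l =
    (\<lambda>y\<in>cube 3. \<Sum>z\<in>({1..n} - {j, k, l}) \<rightarrow>\<^sub>E {0, 1}.
       f (z(j := y 1, k := y 2, l := y 3)) * (\<Prod>m\<in>{1..n} - {j, k, l}. u m (z m)))"

end

theory Submission
  imports Defs
begin

text \<open>
  Some contraction of all variables but two, \<open>x\<^sub>j\<close> and \<open>x\<^sub>k\<close>, has rank two: normalise \<open>f\<close> at a point where it
  does not vanish and take a minimal set of flipped bits on which it is not the product of its values
  at single flips; contract the bits outside the set by \<open>\<delta>\<^sub>0, \<delta>\<^sub>1\<close> and all but two inside it by suitable
  \<open>\<delta>\<^sub>\<plusminus>\<close>. If no such set exists, \<open>f\<close> is a product of unary functions.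

  Suppose now that all ternary gadgets are decomposable, and let \<open>u\<close> be a contraction leaving a matrix
  \<open>M\<^sub>u(x\<^sub>j, x\<^sub>k)\<close> of rank two. Restoring one variable \<open>x\<^sub>i\<close> gives a decomposable ternary function, which can
  only be of the form \<open>h(x\<^sub>i) M\<^sub>u(x\<^sub>j, x\<^sub>k)\<close>. Hence replacing \<open>u\<^sub>i\<close> merely scales \<open>M\<^sub>u\<close>, and two linearly
  independent choices of \<open>u\<^sub>i\<close> scale it by nonzero factors. Restoring the variables one at a time, always
  using both choices, shows that every restriction of \<open>f\<close> to \<open>x\<^sub>j, x\<^sub>k\<close> is a multiple of \<open>M\<^sub>u\<close>, so \<open>f\<close> is
  decomposable.
\<close>

subsection \<open>Arithmetic of algebraic numbers\<close>

text \<open>Viewing the field as a rational vector space reduces closure of the algebraic numbers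
  under sums and products to finite dimension.\<close>

interpretation rat_space: vector_space "\<lambda>(q :: rat) (z :: 'a :: field_char_0). of_rat q * z"
  by unfold_locales (auto simp: algebra_simps of_rat_add of_rat_mult)

text \<open>By dimension, \<open>card T + 1\<close> distinct powers of \<open>z\<close> are linearly
  dependent over the rationals, and a dependence is a nonzero rational polynomial with root
  \<open>z\<close>.\<close>

lemma algebraic_if_powers_in_span:
  fixes z :: "'a :: field_char_0"
  assumes "finite T" and powers: "\<And>n. z ^ n \<in> rat_space.span T"
  shows "algebraic z"
\<comment> \<open>Dependence is a notion for sets, so coinciding powers are treated apart, with the
  polynomial X^i - X^j.\<close>
proof (cases "inj_on (\<lambda>i. z ^ i) {..card T}")
  case False
  then obtain i j where ij: "i \<noteq> j" "z ^ i = z ^ j"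
    unfolding inj_on_def by auto
  let ?p = "monom 1 i - monom 1 j :: 'a poly"
  have "coeff ?p i = 1" using ij by simp
  then have "?p \<noteq> 0" by (metis coeff_0 zero_neq_one)
  moreover have "poly ?p z = 0" using ij by (simp add: poly_monom)
  ultimately show ?thesis
    by (intro algebraicI[of ?p]) auto
next
  case True
  define S where "S = (\<lambda>i. z ^ i) ` {..card T}"
  have "card S = Suc (card T)"
    using True by (simp add: S_def card_image)
  moreover have "S \<subseteq> rat_space.span T"
    using powers by (auto simp: S_def)
  ultimately have "rat_space.dependent S"
    using rat_space.independent_span_bound[OF \<open>finite T\<close>, of S] by auto
  then obtain u v where u: "(\<Sum>v\<in>S. of_rat (u v) * v) = 0" "v \<in> S" "u v \<noteq> 0"
    by (auto simp: rat_space.dependent_finite S_def)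
  define p :: "'a poly" where "p = (\<Sum>i\<le>card T. monom (of_rat (u (z ^ i))) i)"
  have coeff: "coeff p i = (if i \<le> card T then of_rat (u (z ^ i)) else 0)" for i
    by (simp add: p_def coeff_sum)
  obtain i where "i \<le> card T" "v = z ^ i"
    using u(2) by (auto simp: S_def)
  then have "coeff p i \<noteq> 0" using u(3) coeff by simp
  then have "p \<noteq> 0" by auto
  moreover have "poly p z = (\<Sum>i\<le>card T. of_rat (u (z ^ i)) * z ^ i)"
    by (simp add: p_def poly_sum poly_monom)
  then have "poly p z = 0"
    using u(1) True by (simp add: S_def sum.reindex)
  ultimately show ?thesis
    using coeff by (intro algebraicI'[of p]) auto
qed

text \<open>A rational polynomial of degree \<open>d\<close> with root \<open>x\<close> expresses
  \<open>x ^ d\<close> through lower powers; multiplying by \<open>x ^ (n - d)\<close> reduces every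
  higher power.\<close>

lemma algebraic_powers_in_span:
  fixes x :: "'a :: field_char_0"
  assumes "algebraic x"
  obtains d where "\<And>n. x ^ n \<in> rat_space.span ((\<lambda>i. x ^ i) ` {..<d})"
proof -
  obtain p where p: "\<And>i. coeff p i \<in> \<rat>" "p \<noteq> 0" "poly p x = 0"
    using assms by (auto simp: algebraic_altdef)
  define d where "d = degree p"
  have "x ^ n \<in> rat_space.span ((\<lambda>i. x ^ i) ` {..<d})" for n
  proof (induction n rule: less_induct)
    case (less n)
    show ?case
    proof (cases "n < d")
      case True
      then show ?thesis by (intro rat_space.span_base) auto
    next
      case False
      have "0 = (\<Sum>i\<le>d. coeff p i * x ^ i)"
        using p(3) by (simp add: poly_altdef d_def)
      also have "\<dots> = coeff p d * x ^ d + (\<Sum>i<d. coeff p i * x ^ i)"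
        by (simp add: lessThan_Suc_atMost[symmetric])
      finally have "coeff p d * x ^ d = - (\<Sum>i<d. coeff p i * x ^ i)"
        by (simp add: eq_neg_iff_add_eq_0)
      moreover have "coeff p d \<noteq> 0" using p(2) by (simp add: d_def)
      ultimately have "x ^ d = (\<Sum>i<d. - (coeff p i / coeff p d) * x ^ i)"
        by (simp add: sum_negf sum_divide_distrib[symmetric] field_simps)
      then have "x ^ n = (\<Sum>i<d. - (coeff p i / coeff p d) * x ^ i) * x ^ (n - d)"
        using False by (metis le_add_diff_inverse not_less power_add)
      also have "\<dots> = (\<Sum>i<d. - (coeff p i / coeff p d) * x ^ (i + (n - d)))"
        by (simp add: sum_distrib_right power_add mult.assoc)
      also have "\<dots> \<in> rat_space.span ((\<lambda>i. x ^ i) ` {..<d})"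
      proof (rule rat_space.span_sum)
        fix i assume "i \<in> {..<d}"
        then have "x ^ (i + (n - d)) \<in> rat_space.span ((\<lambda>i. x ^ i) ` {..<d})"
          using less False by simp
        moreover have "- (coeff p i / coeff p d) \<in> \<rat>"
          using p(1) by simp
        then obtain q where "- (coeff p i / coeff p d) = of_rat q"
          by (rule Rats_cases)
        ultimately show "- (coeff p i / coeff p d) * x ^ (i + (n - d))
            \<in> rat_space.span ((\<lambda>i. x ^ i) ` {..<d})"
          using rat_space.span_scale by metis
      qed
      finally show ?thesis .
    qed
  qed
  then show ?thesis using that by blast
qed

text \<open>Bilinearity, one factor at a time: for fixed \<open>a\<close> in \<open>A\<close> the
  admissible \<open>b\<close> form a subspace containing \<open>B\<close>; then the same for
  \<open>a\<close> with \<open>b\<close> fixed.\<close>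

lemma mult_in_rat_span:
  fixes a b :: "'a :: field_char_0"
  assumes "a \<in> rat_space.span A" "b \<in> rat_space.span B"
  shows "a * b \<in> rat_space.span ((\<lambda>(a, b). a * b) ` (A \<times> B))"
proof -
  let ?W = "rat_space.span ((\<lambda>(a, b). a * b) ` (A \<times> B))"
  have "rat_space.subspace {b. a * b \<in> ?W}" for a
    by (intro rat_space.subspaceI)
      (auto simp: distrib_left mult.left_commute[of a]
        intro: rat_space.span_add rat_space.span_scale rat_space.span_zero)
  moreover have "B \<subseteq> {b. a * b \<in> ?W}" if "a \<in> A" for a
    using that by (auto intro!: rat_space.span_base)
  ultimately have "rat_space.span B \<subseteq> {b. a * b \<in> ?W}" if "a \<in> A" for a
    using that by (intro rat_space.span_minimal)
  then have "A \<subseteq> {a. a * b \<in> ?W}"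
    using assms(2) by auto
  moreover have "rat_space.subspace {a. a * b \<in> ?W}"
    by (intro rat_space.subspaceI)
      (auto simp: distrib_right mult.assoc
        intro: rat_space.span_add rat_space.span_scale rat_space.span_zero)
  ultimately have "rat_space.span A \<subseteq> {a. a * b \<in> ?W}"
    by (intro rat_space.span_minimal)
  then show ?thesis using assms(1) by auto
qed

text \<open>All \<open>x ^ m * y ^ n\<close> lie in one finite-dimensional space, which therefore
  contains the powers of \<open>x + y\<close>, by the binomial theorem, and of
  \<open>x * y\<close>.\<close>

lemma
  fixes x y :: "'a :: field_char_0"
  assumes "algebraic x" "algebraic y"
  shows algebraic_add: "algebraic (x + y)"
    and algebraic_mult: "algebraic (x * y)"
proof -
  obtain d where d: "\<And>n. x ^ n \<in> rat_space.span ((\<lambda>i. x ^ i) ` {..<d})"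
    using algebraic_powers_in_span assms(1) by blast
  obtain e where e: "\<And>n. y ^ n \<in> rat_space.span ((\<lambda>i. y ^ i) ` {..<e})"
    using algebraic_powers_in_span assms(2) by blast
  define T where "T = (\<lambda>(a, b). a * b) ` (((\<lambda>i. x ^ i) ` {..<d}) \<times> ((\<lambda>i. y ^ i) ` {..<e}))"
  have "finite T" by (simp add: T_def)
  have T: "x ^ m * y ^ n \<in> rat_space.span T" for m n
    unfolding T_def by (rule mult_in_rat_span[OF d e])
  have "of_nat (n choose k) * x ^ k * y ^ (n - k) \<in> rat_space.span T" for n k
    using rat_space.span_scale[OF T, of "of_nat (n choose k)"] by (simp add: mult.assoc)
  then have "(x + y) ^ n \<in> rat_space.span T" for n
    unfolding binomial_ring by (intro rat_space.span_sum)
  then show "algebraic (x + y)"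
    using algebraic_if_powers_in_span \<open>finite T\<close> by blast
  show "algebraic (x * y)"
    by (rule algebraic_if_powers_in_span[OF \<open>finite T\<close>]) (simp add: power_mult_distrib T)
qed

lemma algebraic_sum:
  fixes f :: "'b \<Rightarrow> 'a :: field_char_0"
  assumes "\<And>x. x \<in> A \<Longrightarrow> algebraic (f x)"
  shows "algebraic (\<Sum>x\<in>A. f x)"
  using assms by (induction A rule: infinite_finite_induct) (auto intro: algebraic_add)

lemma algebraic_prod:
  fixes f :: "'b \<Rightarrow> 'a :: field_char_0"
  assumes "\<And>x. x \<in> A \<Longrightarrow> algebraic (f x)"
  shows "algebraic (\<Prod>x\<in>A. f x)"
  using assms by (induction A rule: infinite_finite_induct)
    (auto intro: algebraic_mult algebraic_int_imp_algebraic)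

subsection \<open>Contractions and decomposability\<close>

text \<open>The result still takes a full assignment, whose values on \<open>S\<close> are
  overwritten, so the set of contracted variables can change without renumbering.\<close>

definition contract ::
  "nat set \<Rightarrow> (nat \<Rightarrow> nat \<Rightarrow> complex) \<Rightarrow> ((nat \<Rightarrow> nat) \<Rightarrow> complex) \<Rightarrow> (nat \<Rightarrow> nat) \<Rightarrow> complex" where
  "contract S u f x =
    (\<Sum>z\<in>S \<rightarrow>\<^sub>E {0, 1}. f (\<lambda>i. if i \<in> S then z i else x i) * (\<Prod>m\<in>S. u m (z m)))"

lemma contract_empty [simp]: "contract {} u f x = f x"
  by (simp add: contract_def)

text \<open>Splits off the sum over one variable; this recursion drives the inductions that contract
  or restore variables one at a time.\<close>

lemma contract_insert:
  assumes "finite S" "p \<notin> S"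
  shows "contract (insert p S) u f x =
    u p 0 * contract S u f (x(p := 0)) + u p 1 * contract S u f (x(p := 1))"
proof -
  let ?h = "\<lambda>z. f (\<lambda>i. if i \<in> insert p S then z i else x i) * (\<Prod>m\<in>insert p S. u m (z m))"
  have h: "?h (z(p := b)) = u p b * (f (\<lambda>i. if i \<in> S then z i else (x(p := b)) i) * (\<Prod>m\<in>S. u m (z m)))"
    for z b
  proof -
    have "(\<lambda>i. if i \<in> insert p S then (z(p := b)) i else x i) = (\<lambda>i. if i \<in> S then z i else (x(p := b)) i)"
      using assms by auto
    moreover have "(\<Prod>m\<in>insert p S. u m ((z(p := b)) m)) = u p b * (\<Prod>m\<in>S. u m (z m))"
      using assms by simp (intro disjI2 prod.cong; auto)
    ultimately show ?thesis by simp
  qed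
  have "contract (insert p S) u f x = sum ?h ((\<lambda>(b, z). z(p := b)) ` ({0, 1} \<times> (S \<rightarrow>\<^sub>E {0, 1})))"
    unfolding contract_def by (simp only: PiE_insert_eq)
  also have "\<dots> = (\<Sum>(b, z)\<in>{0, 1} \<times> (S \<rightarrow>\<^sub>E {0, 1}). ?h (z(p := b)))"
    by (rule sum.reindex_cong[OF inj_combinator[OF assms(2)] refl]) (simp only: case_prod_unfold)
  also have "\<dots> = (\<Sum>b\<in>{0, 1}. \<Sum>z\<in>S \<rightarrow>\<^sub>E {0, 1}. ?h (z(p := b)))"
    by (rule sum.cartesian_product[symmetric])
  also have "\<dots> = (\<Sum>b\<in>{0, 1}. u p b * contract S u f (x(p := b)))"
    unfolding h contract_def sum_distrib_left ..
  finally show ?thesis by simp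
qed

lemma contract_cong:
  assumes "\<And>i. i \<notin> S \<Longrightarrow> x i = y i" "\<And>m. m \<in> S \<Longrightarrow> u m = v m"
  shows "contract S u f x = contract S v f y"
proof -
  have "(\<lambda>i. if i \<in> S then z i else x i) = (\<lambda>i. if i \<in> S then z i else y i)" for z
    using assms(1) by auto
  then show ?thesis
    unfolding contract_def using assms(2) by simp
qed

lemma contract_insert_cube:
  assumes "finite S" "p \<notin> S" "b \<in> {0, 1}" "\<And>c. c \<in> {0, 1} \<Longrightarrow> u p c = (if c = b then 1 else 0)"
  shows "contract (insert p S) u f x = contract S u f (x(p := b))"
  using assms by (auto simp: contract_insert)

section \<open>Points of the cube and criteria for decomposability\<close>

lemma cube_update: "x \<in> cube n \<Longrightarrow> p \<in> {1..n} \<Longrightarrow> b \<in> {0, 1} \<Longrightarrow> x(p := b) \<in> cube n"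
  unfolding cube_def by (auto simp: PiE_iff extensional_def)

lemma cube_bit: "x \<in> cube n \<Longrightarrow> p \<in> {1..n} \<Longrightarrow> x p \<in> {0, 1}"
  unfolding cube_def by (rule PiE_mem)

lemma cube_eqI: "x \<in> cube n \<Longrightarrow> y \<in> cube n \<Longrightarrow> (\<And>i. i \<in> {1..n} \<Longrightarrow> x i = y i) \<Longrightarrow> x = y"
  unfolding cube_def by (rule PiE_ext)

text \<open>A set \<open>S\<close> replaces the permutation. Since \<open>\<alpha>\<close> and
  \<open>\<beta>\<close> may take non-algebraic values, the factors are instead slices of
  \<open>f\<close> through a point \<open>z\<close> with \<open>f z \<noteq> 0\<close>, one of them
  divided by \<open>f z\<close>.\<close>

lemma decomposableI:
  assumes f: "f \<in> Upsilon n"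
    and S: "S \<subseteq> {1..n}" "S \<noteq> {}" "S \<noteq> {1..n}"
    and f_eq: "\<And>x. x \<in> cube n \<Longrightarrow> f x = \<alpha> x * \<beta> x"
    and \<alpha>: "\<And>x y. x \<in> cube n \<Longrightarrow> y \<in> cube n \<Longrightarrow> (\<And>i. i \<in> S \<Longrightarrow> x i = y i) \<Longrightarrow> \<alpha> x = \<alpha> y"
    and \<beta>: "\<And>x y. x \<in> cube n \<Longrightarrow> y \<in> cube n \<Longrightarrow> (\<And>i. i \<in> {1..n} - S \<Longrightarrow> x i = y i) \<Longrightarrow> \<beta> x = \<beta> y"
  shows "decomposable n f"
proof -
  define k where "k = card S"
  have "finite S" using S(1) finite_subset by blast
  then have k: "1 \<le> k" "k < n"
    using S psubset_card_mono[of "{1..n}" S] by (auto simp: k_def Suc_le_eq card_gt_0_iff)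
  have "card {1..k} = card S" by (simp add: k_def)
  then obtain g where g: "bij_betw g {1..k} S"
    using \<open>finite S\<close> finite_same_card_bij by blast
  have "card {k+1..n} = card ({1..n} - S)"
    using S(1) \<open>finite S\<close> by (simp add: k_def card_Diff_subset)
  then obtain h where h: "bij_betw h {k+1..n} ({1..n} - S)"
    by (metis finite_Diff finite_atLeastAtMost finite_same_card_bij)
  \<comment> \<open>\<open>\<rho>\<close> enumerates \<open>S\<close> at the positions up to
    \<open>k\<close> and its complement at the later ones.\<close>
  define \<rho> where "\<rho> i = (if i \<in> {1..k} then g i else if i \<in> {k+1..n} then h i else i)" for i
  have \<rho>S: "bij_betw \<rho> {1..k} S"
    using g by (subst bij_betw_cong[of _ _ g]) (auto simp: \<rho>_def)
  have \<rho>S': "bij_betw \<rho> {k+1..n} ({1..n} - S)"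
    using h by (subst bij_betw_cong[of _ _ h]) (auto simp: \<rho>_def)
  have "bij_betw \<rho> ({1..k} \<union> {k+1..n}) (S \<union> ({1..n} - S))"
    by (rule bij_betw_combine[OF \<rho>S \<rho>S']) auto
  moreover have "{1..k} \<union> {k+1..n} = {1..n}" using k by auto
  moreover have "S \<union> ({1..n} - S) = {1..n}" using S(1) by auto
  ultimately have perm: "\<rho> permutes {1..n}"
    by (intro bij_imp_permutes) (auto simp: \<rho>_def)
  have S_iff: "i \<in> S \<longleftrightarrow> inv \<rho> i \<in> {1..k}" if "i \<in> {1..n}" for i
  proof -
    have "inv \<rho> i \<in> {1..n}" "\<rho> (inv \<rho> i) = i"
      using that permutes_in_image[OF permutes_inv[OF perm]] permutes_inverses(1)[OF perm] by auto
    then consider "inv \<rho> i \<in> {1..k}" | "inv \<rho> i \<in> {k+1..n}" "inv \<rho> i \<notin> {1..k}"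
      by fastforce
    then show ?thesis
      using bij_betw_apply[OF \<rho>S] bij_betw_apply[OF \<rho>S'] \<open>\<rho> (inv \<rho> i) = i\<close>
      by cases (metis, metis DiffD2)
  qed
  have sub: "(\<lambda>i\<in>{1..k}. x (\<rho> i)) \<in> cube k" "(\<lambda>i\<in>{1..n - k}. x (\<rho> (k + i))) \<in> cube (n - k)"
    if "x \<in> cube n" for x
  proof -
    have "x (\<rho> i) \<in> {0, 1}" if "i \<in> {1..n}" for i
      using cube_bit[OF \<open>x \<in> cube n\<close>, of "\<rho> i"] that permutes_in_image[OF perm, of i] by blast
    moreover have "{1..k} \<subseteq> {1..n}" "\<And>i. i \<in> {1..n - k} \<Longrightarrow> k + i \<in> {1..n}"
      using k by auto
    ultimately have "\<forall>i\<in>{1..k}. x (\<rho> i) \<in> {0, 1}" "\<forall>i\<in>{1..n - k}. x (\<rho> (k + i)) \<in> {0, 1}"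
      by blast+
    then show "(\<lambda>i\<in>{1..k}. x (\<rho> i)) \<in> cube k"
      "(\<lambda>i\<in>{1..n - k}. x (\<rho> (k + i))) \<in> cube (n - k)"
      unfolding cube_def by (simp_all only: restrict_PiE_iff)
  qed
  have "\<exists>f1 f2. f1 \<in> Upsilon k \<and> f2 \<in> Upsilon (n - k) \<and>
      (\<forall>x\<in>cube n. f x = f1 (\<lambda>i\<in>{1..k}. x (\<rho> i)) * f2 (\<lambda>i\<in>{1..n - k}. x (\<rho> (k + i))))"
  proof (cases "\<exists>z\<in>cube n. f z \<noteq> 0")
    case False
    with sub show ?thesis
      by (intro exI[of _ "\<lambda>x\<in>cube k. 0"] exI[of _ "\<lambda>x\<in>cube (n - k). 0"])
        (auto simp: Upsilon_def)
  next
    case True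
    then obtain z where z: "z \<in> cube n" "f z \<noteq> 0" by auto
    have f_alg: "algebraic (f x)" if "x \<in> cube n" for x
      using f that by (auto simp: Upsilon_def)
    define e1 where "e1 y i = (if i \<in> S then y (inv \<rho> i) else z i)" for y :: "nat \<Rightarrow> nat" and i
    define e2 where "e2 y i = (if i \<in> {1..n} - S then y (inv \<rho> i - k) else z i)" for y :: "nat \<Rightarrow> nat" and i
    define f1 where "f1 = (\<lambda>y\<in>cube k. f (e1 y))"
    define f2 where "f2 = (\<lambda>y\<in>cube (n - k). f (e2 y) / f z)"
    have inv_in: "inv \<rho> i \<in> {1..n}" if "i \<in> {1..n}" for i
      using that permutes_in_image[OF permutes_inv[OF perm]] by simp
    have e1: "e1 y \<in> cube n" if "y \<in> cube k" for y
    proof -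
      have "e1 y i \<in> {0, 1}" if "i \<in> {1..n}" for i
        using cube_bit[OF z(1) that] cube_bit[OF \<open>y \<in> cube k\<close>, of "inv \<rho> i"] S_iff[OF that]
        by (simp add: e1_def)
      moreover have "e1 y i = undefined" if "i \<notin> {1..n}" for i
        using that z(1) S(1) by (auto simp: e1_def cube_def PiE_iff extensional_def)
      ultimately show ?thesis unfolding cube_def by (intro PiE_I) auto
    qed
    have e2: "e2 y \<in> cube n" if "y \<in> cube (n - k)" for y
    proof -
      have "e2 y i \<in> {0, 1}" if "i \<in> {1..n}" for i
      proof (cases "i \<in> S")
        case False
        then have "inv \<rho> i - k \<in> {1..n - k}"
          using S_iff[OF that] inv_in[OF that] by auto
        then show ?thesis
          using cube_bit[OF \<open>y \<in> cube (n - k)\<close>] False that by (simp add: e2_def)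
      qed (use cube_bit[OF z(1) that] in \<open>simp add: e2_def\<close>)
      moreover have "e2 y i = undefined" if "i \<notin> {1..n}" for i
        using that z(1) by (auto simp: e2_def cube_def PiE_iff extensional_def)
      ultimately show ?thesis unfolding cube_def by (intro PiE_I) auto
    qed
    have "f1 \<in> Upsilon k"
      using e1 f_alg by (auto simp: f1_def Upsilon_def)
    moreover have "f2 \<in> Upsilon (n - k)"
      using e2 f_alg z(1) by (auto simp: f2_def Upsilon_def divide_inverse intro!: algebraic_mult algebraic_inverse)
    moreover have "f x = f1 (\<lambda>i\<in>{1..k}. x (\<rho> i)) * f2 (\<lambda>i\<in>{1..n - k}. x (\<rho> (k + i)))"
      if x: "x \<in> cube n" for x
    proof -
      let ?y1 = "\<lambda>i\<in>{1..k}. x (\<rho> i)" and ?y2 = "\<lambda>i\<in>{1..n - k}. x (\<rho> (k + i))"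
      note y1 = sub(1)[OF x] and y2 = sub(2)[OF x]
      have e1_S: "e1 ?y1 i = x i" if "i \<in> S" for i
        using that S_iff[of i] S(1) permutes_inverses(1)[OF perm] by (auto simp: e1_def)
      have e2_S: "e2 ?y2 i = x i" if "i \<in> {1..n} - S" for i
      proof -
        have "inv \<rho> i \<notin> {1..k}" "inv \<rho> i \<in> {1..n}"
          using that S_iff[of i] inv_in[of i] by auto
        then have "inv \<rho> i - k \<in> {1..n - k}" "k + (inv \<rho> i - k) = inv \<rho> i" by auto
        then show ?thesis
          using that permutes_inverses(1)[OF perm] by (simp add: e2_def)
      qed
      have "f (e1 ?y1) = \<alpha> x * \<beta> z"
        using f_eq[OF e1[OF y1]] \<alpha>[OF e1[OF y1] x] \<beta>[OF e1[OF y1] z(1)] e1_S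
        by (auto simp: e1_def)
      moreover have "f (e2 ?y2) = \<alpha> z * \<beta> x"
        using f_eq[OF e2[OF y2]] \<alpha>[OF e2[OF y2] z(1)] \<beta>[OF e2[OF y2] x] e2_S
        by (auto simp: e2_def)
      moreover have "f z = \<alpha> z * \<beta> z" using f_eq z by simp
      ultimately have "f (e1 ?y1) * (f (e2 ?y2) / f z) = \<alpha> x * \<beta> x"
        using z(2) by (simp add: field_simps)
      then show ?thesis
        using y1 y2 f_eq[OF x] by (simp add: f1_def f2_def)
    qed
    ultimately show ?thesis by blast
  qed
  then show ?thesis
    unfolding decomposable_def using perm k by blast
qed

text \<open>For arity three, one side of the splitting consists of a single variable \<open>x\<^sub>p\<close>.\<close>

lemma decomposable_ternaryD:
  assumes "decomposable 3 g"
  obtains p where "p \<in> {1..3}"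
    and "\<And>x y. x \<in> cube 3 \<Longrightarrow> y \<in> cube 3 \<Longrightarrow> g x * g y = g (x(p := y p)) * g (y(p := x p))"
proof -
  obtain \<rho> k f1 f2 where \<rho>: "\<rho> permutes {1..3}" and k: "1 \<le> k" "k < 3"
    and g: "\<And>x. x \<in> cube 3 \<Longrightarrow>
      g x = f1 (\<lambda>i\<in>{1..k}. x (\<rho> i)) * f2 (\<lambda>i\<in>{1..3 - k}. x (\<rho> (k + i)))"
    using assms unfolding decomposable_def by blast
  \<comment> \<open>The position of the variable that stands alone: the first for a split 1+2, the
    last for a split 2+1.\<close>
  define m where "m = (if k = 1 then 1 else 3 :: nat)"
  define p where "p = \<rho> m"
  have "m \<in> {1..3}" by (simp add: m_def)
  then have p: "p \<in> {1..3}" unfolding p_def by (simp only: permutes_in_image[OF \<rho>])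
  have \<rho>_eq: "\<rho> i = p \<longleftrightarrow> i = m" for i
    using permutes_inj[OF \<rho>] by (auto simp: p_def inj_eq)
  have \<rho>_m: "i = m \<Longrightarrow> \<rho> i = p" for i
    by (simp add: p_def)
  have "g x * g y = g (x(p := y p)) * g (y(p := x p))" if "x \<in> cube 3" "y \<in> cube 3" for x y
  proof -
    have upd: "x(p := y p) \<in> cube 3" "y(p := x p) \<in> cube 3"
      using cube_update[OF that(1) p cube_bit[OF that(2) p]]
        cube_update[OF that(2) p cube_bit[OF that(1) p]] .
    consider "k = 1" | "k = 2" using k by linarith
    then show ?thesis
    proof cases
      case 1
      have "(\<lambda>i\<in>{1..k}. (x(p := y p)) (\<rho> i)) = (\<lambda>i\<in>{1..k}. y (\<rho> i))"
        "(\<lambda>i\<in>{1..k}. (y(p := x p)) (\<rho> i)) = (\<lambda>i\<in>{1..k}. x (\<rho> i))"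
        "(\<lambda>i\<in>{1..3 - k}. (x(p := y p)) (\<rho> (k + i))) = (\<lambda>i\<in>{1..3 - k}. x (\<rho> (k + i)))"
        "(\<lambda>i\<in>{1..3 - k}. (y(p := x p)) (\<rho> (k + i))) = (\<lambda>i\<in>{1..3 - k}. y (\<rho> (k + i)))"
        using 1 by (auto simp: \<rho>_eq \<rho>_m m_def intro!: restrict_ext)
      then show ?thesis
        unfolding g[OF that(1)] g[OF that(2)] g[OF upd(1)] g[OF upd(2)] by simp
    next
      case 2
      have "(\<lambda>i\<in>{1..k}. (x(p := y p)) (\<rho> i)) = (\<lambda>i\<in>{1..k}. x (\<rho> i))"
        "(\<lambda>i\<in>{1..k}. (y(p := x p)) (\<rho> i)) = (\<lambda>i\<in>{1..k}. y (\<rho> i))"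
        "(\<lambda>i\<in>{1..3 - k}. (x(p := y p)) (\<rho> (k + i))) = (\<lambda>i\<in>{1..3 - k}. y (\<rho> (k + i)))"
        "(\<lambda>i\<in>{1..3 - k}. (y(p := x p)) (\<rho> (k + i))) = (\<lambda>i\<in>{1..3 - k}. x (\<rho> (k + i)))"
        using 2 by (auto simp: \<rho>_eq \<rho>_m m_def intro!: restrict_ext)
      then show ?thesis
        unfolding g[OF that(1)] g[OF that(2)] g[OF upd(1)] g[OF upd(2)] by simp
    qed
  qed
  then show ?thesis using p that by blast
qed

subsection \<open>Contraction to a nondegenerate binary function\<close>

definition flip :: "(nat \<Rightarrow> nat) \<Rightarrow> nat set \<Rightarrow> nat \<Rightarrow> nat" where
  "flip z B i = (if i \<in> B then 1 - z i else z i)"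

lemma flip_empty [simp]: "flip z {} = z"
  by (auto simp: flip_def)

lemma flip_in_cube: "z \<in> cube n \<Longrightarrow> B \<subseteq> {1..n} \<Longrightarrow> flip z B \<in> cube n"
  unfolding cube_def by (auto simp: flip_def PiE_iff extensional_def)

abbreviation deltas :: "(nat \<Rightarrow> complex) set" where
  "deltas \<equiv> {delta_zero, delta_one, delta_plus, delta_minus}"

lemmas delta_defs = delta_zero_def delta_one_def delta_plus_def delta_minus_def

text \<open>Up to sign the two candidate values are \<open>1 + t\<close> and \<open>1 - t\<close>,
  which cannot both vanish.\<close>

lemma delta_plus_minus_nonzero:
  assumes "b \<in> {0, 1}"
  obtains v where "v \<in> {delta_plus, delta_minus}" "v b + v (1 - b) * t \<noteq> 0" "v (1 - b) \<noteq> 0"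
proof (cases "1 + t = 0")
  case True
  then have "t = - 1" by (simp add: add_eq_0_iff)
  then show ?thesis using assms by (intro that[of delta_minus]) (auto simp: delta_defs)
qed (use assms in \<open>auto intro: that[of delta_plus] simp: delta_defs\<close>)

lemma exists_delta_cube:
  assumes "b \<in> {0, 1 :: nat}"
  obtains v where "v \<in> deltas" "\<And>c. c \<in> {0, 1} \<Longrightarrow> v c = (if c = b then 1 else 0)"
proof (cases "b = 0")
  case True
  then show ?thesis by (intro that[of delta_zero]) (auto simp: delta_defs)
next
  case False
  then have "b = 1" using assms by simp
  then show ?thesis by (intro that[of delta_one]) (auto simp: delta_defs)
qed

text \<open>
  \<open>A\<close> is a minimal set of flips on which \<open>f\<close> fails to be multiplicative relative to \<open>z\<close>. Contracting
  \<open>x\<^sub>p\<close> with \<open>p \<in> A\<close> by \<open>\<delta>\<^sub>+\<close> or \<open>\<delta>\<^sub>-\<close> multiplies the base value by \<open>\<plusminus>(1 \<plusminus> \<phi> p)\<close>, which is nonzero for one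
  of the two, and leaves a function whose only failure is at \<open>A - {p}\<close>.
\<close>

lemma contract_minimal_failure:
  fixes \<phi> :: "nat \<Rightarrow> complex"
  assumes z: "z \<in> cube n" and A: "A \<subseteq> {1..n}"
    and c: "c \<noteq> 0"
    and minimal: "\<And>B. B \<subset> A \<Longrightarrow> f (flip z B) = c * (\<Prod>i\<in>B. \<phi> i)"
    and fails: "f (flip z A) \<noteq> c * (\<Prod>i\<in>A. \<phi> i)"
    and P: "P \<subseteq> {1..n}"
  shows "\<exists>u c d. (\<forall>m. u m \<in> deltas) \<and> c \<noteq> 0 \<and> d \<noteq> 0 \<and>
    (\<forall>B \<subseteq> A - P. contract P u f (flip z B) = c * (\<Prod>i\<in>B. \<phi> i) + (if B = A - P then d else 0))"
proof -
  define Q where "Q P u c d \<longleftrightarrow> (\<forall>m. u m \<in> deltas) \<and> c \<noteq> 0 \<and> d \<noteq> 0 \<and>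
    (\<forall>B \<subseteq> A - P. contract P u f (flip z B) = c * (\<Prod>i\<in>B. \<phi> i) + (if B = A - P then d else 0))"
    for P u c d
  have "finite P" using P finite_subset by blast
  from this P have "\<exists>u c d. Q P u c d"
  proof (induction P)
    case empty
    define d where "d = f (flip z A) - c * (\<Prod>i\<in>A. \<phi> i)"
    have "f (flip z B) = c * (\<Prod>i\<in>B. \<phi> i) + (if B = A then d else 0)" if "B \<subseteq> A" for B
      using minimal[of B] that by (auto simp: d_def)
    moreover have "d \<noteq> 0" using fails by (simp add: d_def)
    ultimately have "Q {} (\<lambda>_. delta_zero) c d"
      unfolding Q_def using c by simp
    then show ?case by blast
  next
    case (insert p P)
    then obtain u c d where "Q P u c d" by auto
    then have u: "\<forall>m. u m \<in> deltas" "c \<noteq> 0" "d \<noteq> 0"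
      and IH: "\<And>B. B \<subseteq> A - P \<Longrightarrow>
        contract P u f (flip z B) = c * (\<Prod>i\<in>B. \<phi> i) + (if B = A - P then d else 0)"
      unfolding Q_def by simp_all
    have bit: "z p \<in> {0, 1}" using cube_bit[OF z] insert.prems by simp
    have same: "contract P (u(p := v)) f x = contract P u f x" for v x
      using insert.hyps by (intro contract_cong) auto
    show ?case
    proof (cases "p \<in> A")
      case False
      \<comment> \<open>Outside \<open>A\<close> no bit is flipped, so \<open>x\<^sub>p\<close> is
        pinned to its base value \<open>z p\<close>.\<close>
      obtain v where v: "v \<in> deltas" "\<And>c. c \<in> {0, 1} \<Longrightarrow> v c = (if c = z p then 1 else 0)"
        using exists_delta_cube[OF bit] by blast
      have "contract (insert p P) (u(p := v)) f (flip z B) =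
          c * (\<Prod>i\<in>B. \<phi> i) + (if B = A - insert p P then d else 0)" if "B \<subseteq> A - insert p P" for B
      proof -
        have "(flip z B)(p := z p) = flip z B" using that by (auto simp: flip_def fun_eq_iff)
        then have "contract (insert p P) (u(p := v)) f (flip z B) = contract P u f (flip z B)"
          using contract_insert_cube[OF insert.hyps bit, of "u(p := v)"] v(2) same by simp
        moreover have "A - insert p P = A - P" using False by auto
        ultimately show ?thesis using IH[of B] that by simp
      qed
      moreover have "\<forall>m. (u(p := v)) m \<in> deltas" using u(1) v(1) by auto
      ultimately have "Q (insert p P) (u(p := v)) c d"
        unfolding Q_def using u(2,3) by simp
      then show ?thesis by blast
    next
      case True
      obtain v where v: "v \<in> {delta_plus, delta_minus}"
        "v (z p) + v (1 - z p) * \<phi> p \<noteq> 0" "v (1 - z p) \<noteq> 0"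
        using delta_plus_minus_nonzero[OF bit] by blast
      let ?c = "c * (v (z p) + v (1 - z p) * \<phi> p)" and ?d = "v (1 - z p) * d"
      have "contract (insert p P) (u(p := v)) f (flip z B) =
          ?c * (\<Prod>i\<in>B. \<phi> i) + (if B = A - insert p P then ?d else 0)" if B: "B \<subseteq> A - insert p P" for B
      proof -
        have "(flip z B)(p := z p) = flip z B" "(flip z B)(p := 1 - z p) = flip z (insert p B)"
          using that by (auto simp: flip_def fun_eq_iff)
        then have "contract (insert p P) (u(p := v)) f (flip z B) =
            v (z p) * contract P u f (flip z B) + v (1 - z p) * contract P u f (flip z (insert p B))"
          using bit by (auto simp: contract_insert[OF insert.hyps] same)
        \<comment> \<open>The set \<open>B\<close> lacks \<open>p\<close>, which lies in
          \<open>A - P\<close>; so the defect \<open>d\<close> can enter only through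
          \<open>insert p B\<close>.\<close>
        moreover have "contract P u f (flip z B) = c * (\<Prod>i\<in>B. \<phi> i)"
        proof -
          have "B \<subseteq> A - P" "B \<noteq> A - P" using B True insert.hyps by auto
          then show ?thesis using IH[of B] by simp
        qed
        moreover have "contract P u f (flip z (insert p B)) =
            c * (\<phi> p * (\<Prod>i\<in>B. \<phi> i)) + (if B = A - insert p P then d else 0)"
        proof -
          have "finite B" "p \<notin> B" using B A finite_subset[of B "{1..n}"] by auto
          moreover have "insert p B \<subseteq> A - P" "insert p B = A - P \<longleftrightarrow> B = A - insert p P"
            using B True insert.hyps by auto
          ultimately show ?thesis using IH[of "insert p B"] by simp
        qed
        ultimately show ?thesis by (simp add: algebra_simps)
      qed
      moreover have "\<forall>m. (u(p := v)) m \<in> deltas" using u(1) v(1) by auto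
      moreover have "?c \<noteq> 0" "?d \<noteq> 0" using u(2,3) v(2,3) by auto
      ultimately have "Q (insert p P) (u(p := v)) ?c ?d"
        unfolding Q_def by simp
      then show ?thesis by blast
    qed
  qed
  then show ?thesis unfolding Q_def .
qed

text \<open>
  Contracting all variables but \<open>x\<^sub>j\<close> and \<open>x\<^sub>k\<close> leaves a matrix of rank two. The inequation below is a
  \<open>2 \<times> 2\<close> minor, written without naming the bits involved.
\<close>

definition entangling ::
  "nat \<Rightarrow> ((nat \<Rightarrow> nat) \<Rightarrow> complex) \<Rightarrow> nat \<Rightarrow> nat \<Rightarrow> (nat \<Rightarrow> nat \<Rightarrow> complex) \<Rightarrow> bool" where
  "entangling n f j k u \<longleftrightarrow> (\<exists>x\<in>cube n. \<exists>y\<in>cube n.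
    contract ({1..n} - {j, k}) u f x * contract ({1..n} - {j, k}) u f y \<noteq>
    contract ({1..n} - {j, k}) u f (x(j := y j)) * contract ({1..n} - {j, k}) u f (y(j := x j)))"

text \<open>The empty set and singletons never fail, by the choice of \<open>\<phi>\<close>, so a
  smallest failing set contains two distinct elements \<open>j\<close> and \<open>k\<close>.\<close>

lemma exists_entangling:
  assumes n: "n \<ge> 2" and nd: "non_decomposable n f"
  obtains j k u where "j \<in> {1..n}" "k \<in> {1..n}" "j \<noteq> k" "\<forall>m. u m \<in> deltas" "entangling n f j k u"
proof -
  have f: "f \<in> Upsilon n" "\<not> decomposable n f"
    using nd by (auto simp: non_decomposable_def)
  have "1 \<in> {1..n}" "2 \<in> {1..n}" using n by simp_all
  moreover have "2 \<notin> {1 :: nat}" by simp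
  ultimately have 1: "{1} \<subseteq> {1..n}" "{1 :: nat} \<noteq> {}" "{1} \<noteq> {1..n}" by blast+
  have "\<exists>z\<in>cube n. f z \<noteq> 0"
  proof (rule ccontr)
    assume "\<not> ?thesis"
    then have "decomposable n f"
      using f(1) 1 by (intro decomposableI[of f n "{1}" "\<lambda>_. 0" "\<lambda>_. 0"]) auto
    with f(2) show False by simp
  qed
  then obtain z where z: "z \<in> cube n" "f z \<noteq> 0" by auto
  define \<phi> where "\<phi> i = f (flip z {i}) / f z" for i
  define fails where "fails A \<longleftrightarrow> A \<subseteq> {1..n} \<and> f (flip z A) \<noteq> f z * (\<Prod>i\<in>A. \<phi> i)" for A
  have "\<exists>A. fails A"
  proof (rule ccontr)
    assume nofail: "\<not> (\<exists>A. fails A)"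
    define \<psi> where "\<psi> x i = (if x i = z i then 1 else \<phi> i)" for x :: "nat \<Rightarrow> nat" and i
    have "f x = (f z * \<psi> x 1) * (\<Prod>i\<in>{1..n} - {1}. \<psi> x i)" if x: "x \<in> cube n" for x
    proof -
      define A where "A = {i \<in> {1..n}. x i \<noteq> z i}"
      have "A \<subseteq> {1..n}" by (auto simp: A_def)
      moreover have "flip z A = x"
      proof (rule cube_eqI[OF flip_in_cube[OF z(1) \<open>A \<subseteq> {1..n}\<close>] x])
        show "flip z A i = x i" if "i \<in> {1..n}" for i
          using cube_bit[OF x that] cube_bit[OF z(1) that] that by (auto simp: flip_def A_def)
      qed
      ultimately have "f x = f z * (\<Prod>i\<in>A. \<phi> i)"
        using nofail by (auto simp: fails_def)
      also have "(\<Prod>i\<in>A. \<phi> i) = (\<Prod>i\<in>{1..n}. \<psi> x i)"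
        by (rule prod.mono_neutral_cong_left) (auto simp: A_def \<psi>_def)
      also have "\<dots> = \<psi> x 1 * (\<Prod>i\<in>{1..n} - {1}. \<psi> x i)"
        using n by (intro prod.remove) auto
      finally show ?thesis by (simp add: mult.assoc)
    qed
    then have "decomposable n f"
      using f(1) 1 by (intro decomposableI[of f n "{1}" "\<lambda>x. f z * \<psi> x 1"
            "\<lambda>x. \<Prod>i\<in>{1..n} - {1}. \<psi> x i"]) (auto simp: \<psi>_def intro!: prod.cong)
    with f(2) show False by simp
  qed
  then obtain A where A: "fails A" "\<And>B. card B < card A \<Longrightarrow> \<not> fails B"
    using ex_has_least_nat[of fails _ card] by (metis leD)
  have "finite A" using A(1) finite_subset by (auto simp: fails_def)
  have minimal: "f (flip z B) = f z * (\<Prod>i\<in>B. \<phi> i)" if "B \<subset> A" for B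
    using A(2)[OF psubset_card_mono[OF \<open>finite A\<close> that]] that A(1) by (auto simp: fails_def)
  have "A \<noteq> {}" using A(1) by (auto simp: fails_def)
  then obtain j where j: "j \<in> A" by auto
  have "A \<noteq> {j}" using A(1) z(2) by (auto simp: fails_def \<phi>_def)
  then obtain k where k: "k \<in> A" "k \<noteq> j" using j by auto
  let ?R = "{1..n} - {j, k}"
  have jk: "j \<in> {1..n}" "k \<in> {1..n}" using j k A(1) by (auto simp: fails_def)
  have AR: "A - ?R = {j, k}" using j k A(1) by (auto simp: fails_def)
  obtain u c d where u: "\<forall>m. u m \<in> deltas" and "c \<noteq> 0" "d \<noteq> 0"
    and C: "\<And>B. B \<subseteq> {j, k} \<Longrightarrow>
      contract ?R u f (flip z B) = c * (\<Prod>i\<in>B. \<phi> i) + (if B = {j, k} then d else 0)"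
    using contract_minimal_failure[OF z(1) _ z(2) minimal, of A ?R] A(1)
    unfolding AR fails_def by auto
  \<comment> \<open>The four entries are \<open>c\<close>, \<open>c * \<phi> j\<close>,
    \<open>c * \<phi> k\<close> and \<open>c * \<phi> j * \<phi> k + d\<close>, so the minor equals
    \<open>c * d\<close>.\<close>
  have "z(j := flip z {j, k} j) = flip z {j}" "(flip z {j, k})(j := z j) = flip z {k}"
    using k by (auto simp: flip_def fun_eq_iff)
  then have "contract ?R u f z * contract ?R u f (flip z {j, k}) \<noteq>
      contract ?R u f (z(j := flip z {j, k} j)) * contract ?R u f ((flip z {j, k})(j := z j))"
    using C[of "{}"] C[of "{j}"] C[of "{k}"] C[of "{j, k}"] k \<open>c \<noteq> 0\<close> \<open>d \<noteq> 0\<close>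
    by (auto simp: algebra_simps doubleton_eq_iff)
  then have "entangling n f j k u"
    unfolding entangling_def using z(1) flip_in_cube[OF z(1), of "{j, k}"] jk by blast
  then show ?thesis using that jk k u by blast
qed

subsection \<open>Ternary gadgets\<close>

definition index3 :: "nat \<Rightarrow> nat \<Rightarrow> nat \<Rightarrow> nat \<Rightarrow> nat" where
  "index3 a b c i = (if i = 1 then a else if i = 2 then b else c)"

lemma index3_simps [simp]:
  "index3 a b c 1 = a" "index3 a b c (Suc 0) = a" "index3 a b c 2 = b" "index3 a b c 3 = c"
  by (simp_all add: index3_def)

lemma index3_inj:
  assumes "a < b" "b < c" "i \<in> {1..3}" "i' \<in> {1..3}"
  shows "index3 a b c i = index3 a b c i' \<longleftrightarrow> i = i'"
proof -
  have "i \<in> {1, 2, 3}" "i' \<in> {1, 2, 3}" using assms(3,4) by auto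
  then show ?thesis using assms(1,2) by auto
qed

lemma index3_restrict_in_cube:
  assumes "{a, b, c} \<subseteq> {1..n}" "x \<in> cube n"
  shows "(\<lambda>i\<in>{1..3}. x (index3 a b c i)) \<in> cube 3"
proof -
  have "index3 a b c i \<in> {1..n}" for i
    using assms(1) by (auto simp: index3_def)
  then have "\<forall>i\<in>{1..3}. x (index3 a b c i) \<in> {0, 1}"
    using cube_bit[OF assms(2)] by blast
  then show ?thesis
    unfolding cube_def by (simp only: restrict_PiE_iff)
qed

text \<open>Links the renumbered gadget to \<open>contract\<close>, in which variables keep their
  names.\<close>

lemma ternary_gadget_eq_contract:
  assumes abc: "a < b" "b < c" "{a, b, c} \<subseteq> {1..n}" and x: "x \<in> cube n"
  shows "ternary_gadget n f u a b c (\<lambda>i\<in>{1..3}. x (index3 a b c i)) = contract ({1..n} - {a, b, c}) u f x"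
proof -
  let ?y = "\<lambda>i\<in>{1..3}. x (index3 a b c i)"
  have y: "?y \<in> cube 3"
    by (rule index3_restrict_in_cube[OF abc(3) x])
  have "z(a := ?y 1, b := ?y 2, c := ?y 3) = (\<lambda>i. if i \<in> {1..n} - {a, b, c} then z i else x i)"
    if "z \<in> ({1..n} - {a, b, c}) \<rightarrow>\<^sub>E {0, 1}" for z
  proof
    fix i
    \<comment> \<open>Both assignments take the default \<open>undefined\<close> outside the index
      range, so the two points agree as functions.\<close>
    have "z i = x i" if "i \<notin> {1..n}"
    proof -
      have "z i = undefined" using PiE_arb[OF \<open>z \<in> _\<close>, of i] that by blast
      moreover have "x i = undefined" using x that unfolding cube_def by (rule PiE_arb)
      ultimately show ?thesis by simp
    qed
    then show "(z(a := ?y 1, b := ?y 2, c := ?y 3)) i = (if i \<in> {1..n} - {a, b, c} then z i else x i)"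
      using abc by auto
  qed
  then show ?thesis
    using y unfolding ternary_gadget_def contract_def by simp
qed

lemma algebraic_delta: "v \<in> deltas \<Longrightarrow> algebraic (v b)"
  by (intro rat_imp_algebraic) (auto simp: delta_defs)

text \<open>Here closure of the algebraic numbers is used: a gadget that is not
  \<open>non_decomposable\<close> is then really decomposable.\<close>

lemma ternary_gadget_in_Upsilon:
  assumes f: "f \<in> Upsilon n" and abc: "{a, b, c} \<subseteq> {1..n}"
    and u: "\<forall>m\<in>{1..n} - {a, b, c}. u m \<in> deltas"
  shows "ternary_gadget n f u a b c \<in> Upsilon 3"
proof -
  have "algebraic (f (z(a := y 1, b := y 2, c := y 3)) * (\<Prod>m\<in>{1..n} - {a, b, c}. u m (z m)))"
    if y: "y \<in> cube 3" and z: "z \<in> ({1..n} - {a, b, c}) \<rightarrow>\<^sub>E {0, 1}" for y z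
  proof (rule algebraic_mult)
    have "y 1 \<in> {0, 1}" "y 2 \<in> {0, 1}" "y 3 \<in> {0, 1}"
      by (rule cube_bit[OF y]; simp)+
    then have "z(a := y 1, b := y 2, c := y 3) \<in> cube n"
      using z abc unfolding cube_def PiE_iff extensional_def by auto
    then show "algebraic (f (z(a := y 1, b := y 2, c := y 3)))"
      using f by (auto simp: Upsilon_def)
    show "algebraic (\<Prod>m\<in>{1..n} - {a, b, c}. u m (z m))"
      using u by (intro algebraic_prod algebraic_delta) blast
  qed
  then show ?thesis
    unfolding ternary_gadget_def Upsilon_def
    by (intro restrict_PiE_iff[THEN iffD2] ballI CollectI algebraic_sum)
qed

lemma contract_exchange_sorted:
  assumes abc: "a < b" "b < c" "{a, b, c} \<subseteq> {1..n}"
    and dec: "decomposable 3 (ternary_gadget n f u a b c)"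
  defines "T \<equiv> contract ({1..n} - {a, b, c}) u f"
  obtains p where "p \<in> {a, b, c}"
    and "\<And>x y. x \<in> cube n \<Longrightarrow> y \<in> cube n \<Longrightarrow> T x * T y = T (x(p := y p)) * T (y(p := x p))"
proof -
  let ?g = "ternary_gadget n f u a b c"
  define pick where "pick x = (\<lambda>i\<in>{1..3}. x (index3 a b c i))" for x :: "nat \<Rightarrow> nat"
  have g: "?g (pick x) = T x" if "x \<in> cube n" for x
    unfolding pick_def T_def by (rule ternary_gadget_eq_contract[OF abc that])
  obtain q where q: "q \<in> {1..3}"
    and ex: "\<And>x y. x \<in> cube 3 \<Longrightarrow> y \<in> cube 3 \<Longrightarrow> ?g x * ?g y = ?g (x(q := y q)) * ?g (y(q := x q))"
    using decomposable_ternaryD[OF dec] by blast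
  define p where "p = index3 a b c q"
  have p: "p \<in> {a, b, c}" by (simp add: p_def index3_def)
  have pick: "pick x \<in> cube 3" if "x \<in> cube n" for x
    unfolding pick_def by (rule index3_restrict_in_cube[OF abc(3) that])
  have upd: "(pick x)(q := pick y q) = pick (x(p := y p))" for x y
    using q index3_inj[OF abc(1,2) _ q] by (auto simp: pick_def p_def fun_eq_iff)
  have "T x * T y = T (x(p := y p)) * T (y(p := x p))" if xy: "x \<in> cube n" "y \<in> cube n" for x y
  proof -
    have "p \<in> {1..n}" using p abc(3) by blast
    then have "x(p := y p) \<in> cube n" "y(p := x p) \<in> cube n"
      using cube_update cube_bit xy by metis+
    then show ?thesis
      using ex[OF pick[OF xy(1)] pick[OF xy(2)]] xy by (simp only: upd g)
  qed
  then show ?thesis using that p by blast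
qed

definition gadgets_decomposable :: "nat \<Rightarrow> ((nat \<Rightarrow> nat) \<Rightarrow> complex) \<Rightarrow> bool" where
  "gadgets_decomposable n f \<longleftrightarrow> (\<forall>a b c u. a < b \<longrightarrow> b < c \<longrightarrow> {a, b, c} \<subseteq> {1..n} \<longrightarrow>
    (\<forall>m. u m \<in> deltas) \<longrightarrow> decomposable 3 (ternary_gadget n f u a b c))"

lemma exists_sorted3:
  fixes i j k :: nat
  assumes "i \<noteq> j" "i \<noteq> k" "j \<noteq> k"
  obtains a b c where "a < b" "b < c" "{a, b, c} = {j, k, i}"
proof -
  consider "i < j" "j < k" | "i < k" "k < j" | "j < i" "i < k" | "j < k" "k < i" | "k < i" "i < j" | "k < j" "j < i"
    using assms by linarith
  then show ?thesis
    by cases (rule that, assumption, assumption, blast)+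
qed

text \<open>Gadgets require increasing indices, but the exchange identity depends only on the set of
  the three variables.\<close>

lemma contract_exchange:
  assumes gadgets: "gadgets_decomposable n f" and u: "\<forall>m. u m \<in> deltas"
    and jki: "{j, k, i} \<subseteq> {1..n}" "i \<noteq> j" "i \<noteq> k" "j \<noteq> k"
  defines "T \<equiv> contract ({1..n} - {j, k, i}) u f"
  obtains p where "p \<in> {j, k, i}"
    and "\<And>x y. x \<in> cube n \<Longrightarrow> y \<in> cube n \<Longrightarrow> T x * T y = T (x(p := y p)) * T (y(p := x p))"
proof -
  obtain a b c where abc: "a < b" "b < c" "{a, b, c} = {j, k, i}"
    using exists_sorted3[OF jki(2-4)] .
  moreover have "{a, b, c} \<subseteq> {1..n}" using abc(3) jki(1) by simp
  moreover have "decomposable 3 (ternary_gadget n f u a b c)"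
    using gadgets u calculation unfolding gadgets_decomposable_def by blast
  ultimately show ?thesis
    using contract_exchange_sorted[of a b c n f u] that unfolding T_def by metis
qed

section \<open>Proportionality of restrictions when all ternary gadgets decompose\<close>

lemma contract_rest_cong:
  assumes "x \<in> cube n" "y \<in> cube n" "x j = y j" "x k = y k"
  shows "contract ({1..n} - {j, k}) u f x = contract ({1..n} - {j, k}) u f y"
proof (rule contract_cong)
  fix i assume "i \<notin> {1..n} - {j, k}"
  moreover have "x i = y i" if "i \<notin> {1..n}"
    using assms(1,2) that unfolding cube_def by (metis PiE_arb)
  ultimately show "x i = y i" using assms(3,4) by blast
qed simp

text \<open>A nonzero minor has a nonzero entry in one of its two products.\<close>

lemma entangling_nonzero:
  assumes "entangling n f j k u" "j \<in> {1..n}"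
  obtains w where "w \<in> cube n" "contract ({1..n} - {j, k}) u f w \<noteq> 0"
proof -
  obtain x y where xy: "x \<in> cube n" "y \<in> cube n"
    "contract ({1..n} - {j, k}) u f x * contract ({1..n} - {j, k}) u f y \<noteq>
     contract ({1..n} - {j, k}) u f (x(j := y j)) * contract ({1..n} - {j, k}) u f (y(j := x j))"
    using assms(1) unfolding entangling_def by blast
  have "x(j := y j) \<in> cube n" using xy assms(2) cube_update cube_bit by metis
  then show ?thesis using that xy by (metis mult_zero_left)
qed

text \<open>
  The ternary function on \<open>x\<^sub>j, x\<^sub>k, x\<^sub>i\<close> splits off a single variable. That variable can be neither \<open>x\<^sub>j\<close> nor
  \<open>x\<^sub>k\<close>, since the split would survive the contraction of \<open>x\<^sub>i\<close>; so it is \<open>x\<^sub>i\<close>.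
\<close>

lemma contract_proportional_step:
  assumes gadgets: "gadgets_decomposable n f" and u: "\<forall>m. u m \<in> deltas"
    and ent: "entangling n f j k u"
    and jki: "{j, k, i} \<subseteq> {1..n}" "i \<noteq> j" "i \<noteq> k" "j \<noteq> k"
  obtains h where "\<And>x b. x \<in> cube n \<Longrightarrow> b \<in> {0, 1} \<Longrightarrow>
    contract ({1..n} - {j, k, i}) u f (x(i := b)) = h b * contract ({1..n} - {j, k}) u f x"
proof -
  define T where "T = contract ({1..n} - {j, k, i}) u f"
  define M where "M = contract ({1..n} - {j, k}) u f"
  have insert_i: "{1..n} - {j, k} = insert i ({1..n} - {j, k, i})" using jki by auto
  have M: "M x = u i 0 * T (x(i := 0)) + u i 1 * T (x(i := 1))" for x
    unfolding M_def T_def insert_i by (rule contract_insert) auto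
  have V: "j \<in> {1..n}" "k \<in> {1..n}" "i \<in> {1..n}" using jki by auto
  obtain p where p: "p \<in> {j, k, i}"
    and ex: "\<And>x y. x \<in> cube n \<Longrightarrow> y \<in> cube n \<Longrightarrow> T x * T y = T (x(p := y p)) * T (y(p := x p))"
    using contract_exchange[OF gadgets u jki] unfolding T_def by blast
  have upd: "x(i := b) \<in> cube n" if "x \<in> cube n" "b \<in> {0, 1}" for x b
    using cube_update[OF that(1) V(3) that(2)] .
  \<comment> \<open>For \<open>p \<noteq> i\<close> the exchange does not touch
    \<open>x\<^sub>i\<close>, so the four identities in the bits of \<open>x\<^sub>i\<close> can be
    summed with weights from \<open>u i\<close>.\<close>
  have M_ex: "M x * M y = M (x(p := y p)) * M (y(p := x p))"
    if "p \<noteq> i" and xy: "x \<in> cube n" "y \<in> cube n" for x y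
  proof -
    have "T (x(i := b)) * T (y(i := b')) = T (x(p := y p, i := b)) * T (y(p := x p, i := b'))"
      if "b \<in> {0, 1}" "b' \<in> {0, 1}" for b b'
      using ex[OF upd[OF xy(1) that(1)] upd[OF xy(2) that(2)]] \<open>p \<noteq> i\<close> by (simp add: fun_upd_twist)
    from this[of 0 0] this[of 0 1] this[of 1 0] this[of 1 1] show ?thesis
      unfolding M by (simp add: algebra_simps)
  qed
  obtain x0 y0 where xy0: "x0 \<in> cube n" "y0 \<in> cube n"
    "M x0 * M y0 \<noteq> M (x0(j := y0 j)) * M (y0(j := x0 j))"
    using ent unfolding entangling_def M_def by blast
  have "p \<noteq> j" using M_ex xy0 jki by metis
  moreover have "p \<noteq> k"
  proof
    assume "p = k"
    have cubes: "x0(j := y0 j) \<in> cube n" "y0(j := x0 j) \<in> cube n" "x0(k := y0 k) \<in> cube n" "y0(k := x0 k) \<in> cube n"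
      using xy0 V cube_update cube_bit by metis+
    \<comment> \<open>As \<open>M\<close> sees only \<open>x\<^sub>j\<close> and
      \<open>x\<^sub>k\<close>, exchanging \<open>x\<^sub>k\<close> yields the same two entries as
      exchanging \<open>x\<^sub>j\<close>, in the other order.\<close>
    have "M (x0(k := y0 k)) = M (y0(j := x0 j))" "M (y0(k := x0 k)) = M (x0(j := y0 j))"
      unfolding M_def by (rule contract_rest_cong; simp add: cubes jki(4) jki(4)[symmetric])+
    then show False
      using M_ex[OF _ xy0(1,2)] xy0(3) \<open>p = k\<close> jki(3) by (simp add: mult.commute)
  qed
  ultimately have "p = i" using p by blast
  obtain w where w: "w \<in> cube n" "M w \<noteq> 0"
    using entangling_nonzero[OF ent V(1)] unfolding M_def by blast
  have "T (x(i := b)) = T (w(i := b)) / M w * M x" if x: "x \<in> cube n" and b: "b \<in> {0, 1}" for x b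
  proof -
    \<comment> \<open>Summing over \<open>b'\<close> with weights \<open>u i b'\<close> turns one
      factor on each side into \<open>M\<close>.\<close>
    have "T (x(i := b)) * T (w(i := b')) = T (x(i := b')) * T (w(i := b))" if "b' \<in> {0, 1}" for b'
      using ex[OF upd[OF x b] upd[OF w(1) that]] \<open>p = i\<close> by simp
    from this[of 0] this[of 1] have "T (x(i := b)) * M w = M x * T (w(i := b))"
      unfolding M by (simp add: algebra_simps)
    then show ?thesis using w(2) by (simp add: field_simps)
  qed
  then show ?thesis using that[of "\<lambda>b. T (w(i := b)) / M w"] unfolding T_def M_def by blast
qed

text \<open>\<open>delta_zero\<close> and \<open>delta_one\<close> read off \<open>h0\<close> and
  \<open>h1\<close>; if one of these vanishes, \<open>delta_plus\<close> takes the place of its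
  delta.\<close>

lemma two_deltas:
  assumes "h0 \<noteq> 0 \<or> h1 \<noteq> 0"
  obtains v w where "v \<in> deltas" "w \<in> deltas" "v 0 * h0 + v 1 * h1 \<noteq> 0" "w 0 * h0 + w 1 * h1 \<noteq> 0"
    "v 0 * w 1 - v 1 * w 0 \<noteq> 0"
proof -
  consider "h0 = 0" "h1 \<noteq> 0" | "h0 \<noteq> 0" "h1 = 0" | "h0 \<noteq> 0" "h1 \<noteq> 0" using assms by blast
  then show ?thesis
  proof cases
    case 1
    then show ?thesis by (intro that[of delta_one delta_plus]) (simp_all add: delta_defs)
  next
    case 2
    then show ?thesis by (intro that[of delta_zero delta_plus]) (simp_all add: delta_defs)
  next
    case 3
    then show ?thesis by (intro that[of delta_zero delta_one]) (simp_all add: delta_defs)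
  qed
qed

text \<open>\<open>S\<close> holds the restored variables and \<open>a\<close> fixes all values
  outside \<open>j\<close>, \<open>k\<close>. The induction keeps \<open>u\<close> arbitrary because
  it is applied to two modifications of \<open>u\<close> at \<open>p\<close>.\<close>

lemma contract_proportional:
  assumes gadgets: "gadgets_decomposable n f"
    and jk: "j \<in> {1..n}" "k \<in> {1..n}" "j \<noteq> k"
    and S: "S \<subseteq> {1..n} - {j, k}"
    and "\<forall>m. u m \<in> deltas" "entangling n f j k u"
  shows "\<exists>c. \<forall>y\<in>cube n. (\<forall>i\<in>{1..n} - {j, k}. y i = a i) \<longrightarrow>
    contract ({1..n} - {j, k} - S) u f y = c * contract ({1..n} - {j, k}) u f y"
proof -
  define R where "R = {1..n} - {j, k}"
  define agree where "agree y \<longleftrightarrow> (\<forall>i\<in>R. y i = a i)" for y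
  have "finite S" using S by (rule finite_subset) simp
  from this S assms(6,7) show ?thesis
    unfolding R_def[symmetric] agree_def[symmetric]
  proof (induction S arbitrary: u)
    case empty
    show ?case by (intro exI[of _ 1]) simp
  next
    case (insert p S)
    have p: "p \<in> R" "p \<in> {1..n}" and "S \<subseteq> R" "p \<notin> S"
      using insert.prems(1) insert.hyps by (auto simp: R_def)
    have jkp: "{j, k, p} \<subseteq> {1..n}" "p \<noteq> j" "p \<noteq> k" using p jk by (auto simp: R_def)
    have R_p: "{1..n} - {j, k, p} = R - {p}" "R = insert p (R - {p})"
      using p by (auto simp: R_def)
    have fin: "finite (R - {p})" "finite (R - insert p S)" by (simp_all add: R_def)
    obtain h where h: "\<And>x b. x \<in> cube n \<Longrightarrow> b \<in> {0, 1} \<Longrightarrow>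
        contract (R - {p}) u f (x(p := b)) = h b * contract R u f x"
      using contract_proportional_step[OF gadgets insert.prems(2,3) jkp jk(3)]
      unfolding R_p(1) R_def[symmetric] by blast
    have M_upd: "contract R (u(p := v)) f x = (v 0 * h 0 + v 1 * h 1) * contract R u f x"
      if "x \<in> cube n" for v x
    proof -
      have "contract R (u(p := v)) f x =
          v 0 * contract (R - {p}) (u(p := v)) f (x(p := 0)) + v 1 * contract (R - {p}) (u(p := v)) f (x(p := 1))"
        using contract_insert[OF fin(1), of p "u(p := v)" f x] R_p(2) by simp
      moreover have "contract (R - {p}) (u(p := v)) f y = contract (R - {p}) u f y" for y
        by (rule contract_cong) auto
      ultimately show ?thesis
        using h[OF that, of 0] h[OF that, of 1] by (simp add: algebra_simps)
    qed
    obtain w where w: "w \<in> cube n" "contract R u f w \<noteq> 0"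
      using entangling_nonzero[OF insert.prems(3) jk(1)] unfolding R_def by blast
    \<comment> \<open>With \<open>v = u p\<close> nothing is modified; if both values of
      \<open>h\<close> vanished, the nonzero entry at \<open>w\<close> would be zero.\<close>
    have "h 0 \<noteq> 0 \<or> h 1 \<noteq> 0"
      using M_upd[OF w(1), of "u p"] w(2) by auto
    then obtain v v' where v: "v \<in> deltas" "v' \<in> deltas"
      "v 0 * h 0 + v 1 * h 1 \<noteq> 0" "v' 0 * h 0 + v' 1 * h 1 \<noteq> 0" and indep: "v 0 * v' 1 - v 1 * v' 0 \<noteq> 0"
      by (rule two_deltas)
    \<comment> \<open>\<open>X b\<close> is the contraction with \<open>p\<close> restored as well
      and \<open>x\<^sub>p\<close> set to \<open>b\<close>; the induction hypothesis controls only
      its weighted sums over \<open>b\<close>.\<close>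
    define X where "X b y = contract (R - insert p S) u f (y(p := b))" for b y
    have IH: "\<exists>c. \<forall>y\<in>cube n. agree y \<longrightarrow> v 0 * X 0 y + v 1 * X 1 y = c * contract R u f y"
      if v: "v \<in> deltas" "v 0 * h 0 + v 1 * h 1 \<noteq> 0" for v
    proof -
      let ?s = "v 0 * h 0 + v 1 * h 1"
      have "\<forall>m. (u(p := v)) m \<in> deltas" using insert.prems(2) v(1) by auto
      moreover have "entangling n f j k (u(p := v))"
      proof -
        obtain x y where xy: "x \<in> cube n" "y \<in> cube n"
          "contract R u f x * contract R u f y \<noteq> contract R u f (x(j := y j)) * contract R u f (y(j := x j))"
          using insert.prems(3) unfolding entangling_def R_def by blast
        moreover have "x(j := y j) \<in> cube n" "y(j := x j) \<in> cube n"
          using xy jk(1) cube_update cube_bit by metis+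
        ultimately have "contract R (u(p := v)) f x * contract R (u(p := v)) f y \<noteq>
            contract R (u(p := v)) f (x(j := y j)) * contract R (u(p := v)) f (y(j := x j))"
          using v(2) by (simp add: M_upd)
        then show ?thesis using xy(1,2) unfolding entangling_def R_def by blast
      qed
      ultimately obtain c where c: "\<And>y. y \<in> cube n \<Longrightarrow> agree y \<Longrightarrow>
          contract (R - S) (u(p := v)) f y = c * contract R (u(p := v)) f y"
        using insert.IH[OF \<open>S \<subseteq> R\<close>] by blast
      have "R - S = insert p (R - insert p S)" using p \<open>p \<notin> S\<close> by blast
      moreover have "contract (R - insert p S) (u(p := v)) f y = contract (R - insert p S) u f y" for y
        by (rule contract_cong) auto
      ultimately have "contract (R - S) (u(p := v)) f y = v 0 * X 0 y + v 1 * X 1 y" for y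
        using contract_insert[OF fin(2), of p "u(p := v)" f y] by (simp add: X_def)
      then show ?thesis using c M_upd by (intro exI[of _ "c * ?s"]) simp
    qed
    obtain c where c: "\<And>y. y \<in> cube n \<Longrightarrow> agree y \<Longrightarrow> v 0 * X 0 y + v 1 * X 1 y = c * contract R u f y"
      using IH[OF v(1,3)] by blast
    obtain c' where c': "\<And>y. y \<in> cube n \<Longrightarrow> agree y \<Longrightarrow> v' 0 * X 0 y + v' 1 * X 1 y = c' * contract R u f y"
      using IH[OF v(2,4)] by blast
    \<comment> \<open>Cramer's rule: the two independent weighted sums determine
      \<open>X 0 y\<close> and \<open>X 1 y\<close>, both as multiples of the same matrix
      entry.\<close>
    define D where "D = v 0 * v' 1 - v 1 * v' 0"
    have "D \<noteq> 0" using indep by (simp add: D_def)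
    define e where "e b = (if b = 0 then (v' 1 * c - v 1 * c') / D else (v 0 * c' - v' 0 * c) / D)" for b :: nat
    have "contract (R - insert p S) u f y = e (a p) * contract R u f y" if y: "y \<in> cube n" "agree y" for y
    proof -
      let ?M = "contract R u f y"
      have "D * X 0 y = v' 1 * (v 0 * X 0 y + v 1 * X 1 y) - v 1 * (v' 0 * X 0 y + v' 1 * X 1 y)"
        "D * X 1 y = v 0 * (v' 0 * X 0 y + v' 1 * X 1 y) - v' 0 * (v 0 * X 0 y + v 1 * X 1 y)"
        by (simp_all add: D_def algebra_simps)
      then have "D * X 0 y = (v' 1 * c - v 1 * c') * ?M" "D * X 1 y = (v 0 * c' - v' 0 * c) * ?M"
        unfolding c[OF y] c'[OF y] by (simp_all add: algebra_simps)
      then have "X 0 y = e 0 * ?M" "X 1 y = e 1 * ?M"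
        using \<open>D \<noteq> 0\<close> by (simp_all add: e_def field_simps)
      moreover have "y p = a p" using y(2) p(1) by (simp add: agree_def)
      moreover have "y p \<in> {0, 1}" using cube_bit[OF y(1) p(2)] .
      ultimately have "X (y p) y = e (a p) * ?M" by auto
      then show ?thesis by (simp add: X_def)
    qed
    then show ?case by blast
  qed
qed

theorem theorem5p4:
  fixes n :: nat and f :: "(nat \<Rightarrow> nat) \<Rightarrow> complex"
  assumes "n \<ge> 3"
    and "f \<in> Upsilon n"
    and "non_decomposable n f"
  shows "\<exists>j k l u. j \<in> {1..n} \<and> k \<in> {1..n} \<and> l \<in> {1..n} \<and> j < k \<and> k < l \<and>
    (\<forall>m\<in>{1..n} - {j, k, l}. u m \<in> {delta_zero, delta_one, delta_plus, delta_minus}) \<and>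
    non_decomposable 3 (ternary_gadget n f u j k l)"
proof (rule ccontr)
  assume none: "\<not> ?thesis"
  have gadgets: "gadgets_decomposable n f"
    unfolding gadgets_decomposable_def
  proof (intro allI impI)
    fix a b c and u :: "nat \<Rightarrow> nat \<Rightarrow> complex"
    assume abc: "a < b" "b < c" "{a, b, c} \<subseteq> {1..n}" and u: "\<forall>m. u m \<in> deltas"
    then have "ternary_gadget n f u a b c \<in> Upsilon 3"
      using ternary_gadget_in_Upsilon[OF assms(2)] by simp
    moreover have "\<not> non_decomposable 3 (ternary_gadget n f u a b c)"
      using none abc u by blast
    ultimately show "decomposable 3 (ternary_gadget n f u a b c)"
      by (simp add: non_decomposable_def)
  qed
  obtain j k u where jk: "j \<in> {1..n}" "k \<in> {1..n}" "j \<noteq> k"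
    and u: "\<forall>m. u m \<in> deltas" "entangling n f j k u"
    using exists_entangling[OF _ assms(3)] assms(1) by auto
  \<comment> \<open>With all of \<open>?R\<close> restored the contraction is \<open>f\<close>
    itself. The scalar is chosen as a function of \<open>a\<close>, and
    \<open>a = restrict x ?R\<close> makes it depend only on the variables in
    \<open>?R\<close>.\<close>
  let ?R = "{1..n} - {j, k}"
  have "\<forall>a. \<exists>c. \<forall>y\<in>cube n. (\<forall>i\<in>?R. y i = a i) \<longrightarrow> f y = c * contract ?R u f y"
    using contract_proportional[OF gadgets jk order_refl u] by simp
  then obtain c where c: "\<And>a y. y \<in> cube n \<Longrightarrow> (\<forall>i\<in>?R. y i = a i) \<Longrightarrow> f y = c a * contract ?R u f y"
    by metis
  have "decomposable n f"
  proof (rule decomposableI[OF assms(2), of "{j, k}" "contract ?R u f" "\<lambda>x. c (restrict x ?R)"])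
    show "{j, k} \<subseteq> {1..n}" "{j, k} \<noteq> {}" using jk by auto
    have "card {j, k} = 2" "card {1..n} = n" using jk by simp_all
    then show "{j, k} \<noteq> {1..n}" using assms(1) by auto
    show "f x = contract ?R u f x * c (restrict x ?R)" if "x \<in> cube n" for x
      using c[OF that, of "restrict x ?R"] by (simp add: mult.commute)
    show "contract ?R u f x = contract ?R u f y"
      if "x \<in> cube n" "y \<in> cube n" "\<And>i. i \<in> {j, k} \<Longrightarrow> x i = y i" for x y
      using that by (intro contract_rest_cong) auto
    show "c (restrict x ?R) = c (restrict y ?R)"
      if "\<And>i. i \<in> {1..n} - {j, k} \<Longrightarrow> x i = y i" for x y
      using that by (intro arg_cong[of _ _ c] restrict_ext) blast
  qed
  then show False using assms(3) by (simp add: non_decomposable_def)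
qed

end
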